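(* For $i=1,2,3$ let $G_{i}$ be an $r_{i}$-regular graph on $n_{i}$ vertices, with adjacency spectra $\{r_{1}=\lambda_{1},\lambda_{2},\ldots,\lambda_{n_{1}}\}$, $\{r_{2}=\mu_{1},\mu_{2},\ldots,\mu_{n_{2}}\}$ and $\{r_{3}=\delta_{1},\delta_{2},\ldots,\delta_{n_{3}}\}$ respectively. Then the distance Laplacian spectrum of $G_{1}\nabla(G_{2}\cup G_{3})$ consists of the eigenvalues $0$, $n_{1}+n_{2}+n_{3}$, $n_{1}+2n_{2}+2n_{3}$, $2n_{1}+n_{2}+n_{3}-r_{1}+\lambda_{j}$ for $j=2,\ldots,n_{1}$, $n_{1}+2n_{2}+2n_{3}-r_{2}+\mu_{j}$ for $j=2,\ldots,n_{2}$, and $n_{1}+2n_{2}+2n_{3}-r_{3}+\delta_{j}$ for $j=2,\ldots,n_{3}$.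
   Context: $G_2\cup G_3$ is the disjoint union; the join $H_1\nabla H_2$ of vertex-disjoint graphs is obtained from $H_1\cup H_2$ by joining every vertex of $H_1$ to every vertex of $H_2$. For a connected graph, $\mathcal{D}$ is its distance matrix, $Tr$ the diagonal matrix of vertex transmissions ($Tr(u)=\sum_v d(u,v)$), and the distance Laplacian matrix is $\mathcal{L}=Tr-\mathcal{D}$. *)

theory Defs
  imports
    "Graph_Theory.Graph_Theory"
    "Jordan_Normal_Form.Char_Poly"
begin

text \<open>
  Finite simple graphs are those satisfying \<open>pair_graph\<close>: an undirected edge \<open>uv\<close> is the pair of
  arcs \<open>(u,v)\<close>, \<open>(v,u)\<close>. Hence the degree of a vertex is its \<open>out_degree\<close>.
\<close>

definition regular_graph :: "nat \<Rightarrow> 'a pair_pre_digraph \<Rightarrow> bool" where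
  "regular_graph r G \<longleftrightarrow> pair_graph G \<and> (\<forall>v \<in> pverts G. out_degree (with_proj G) v = r)"

text \<open>This is the disjoint union when the vertex sets are disjoint, which \<open>pair_union\<close> does
  not enforce; likewise \<open>pair_join\<close> is the join of vertex-disjoint graphs only.\<close>

definition pair_union :: "'a pair_pre_digraph \<Rightarrow> 'a pair_pre_digraph \<Rightarrow> 'a pair_pre_digraph" where
  "pair_union G H = \<lparr> pverts = pverts G \<union> pverts H, parcs = parcs G \<union> parcs H \<rparr>"

definition pair_join :: "'a pair_pre_digraph \<Rightarrow> 'a pair_pre_digraph \<Rightarrow> 'a pair_pre_digraph"
    (infixr \<open>\<nabla>\<close> 65) where
  "G \<nabla> H = \<lparr> pverts = pverts (pair_union G H),
     parcs = parcs (pair_union G H) \<union> pverts G \<times> pverts H \<union> pverts H \<times> pverts G \<rparr>"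

text \<open>The length of a shortest walk. The conversion to \<open>real\<close> sends \<open>\<infinity>\<close> to \<open>0\<close>, so this is
  the distance only between mutually reachable vertices, as in a connected graph.\<close>

definition graph_dist :: "'a pair_pre_digraph \<Rightarrow> 'a \<Rightarrow> 'a \<Rightarrow> real" where
  "graph_dist G u v = real_of_ereal (wf_digraph.\<mu> (with_proj G) (\<lambda>_. 1) u v)"

definition transmission :: "'a pair_pre_digraph \<Rightarrow> 'a \<Rightarrow> real" where
  "transmission G u = (\<Sum>v \<in> pverts G. graph_dist G u v)"

text \<open>Matrices of a graph are taken with respect to a listing \<open>vs\<close> of its vertices.\<close>

definition vertex_listing :: "'a list \<Rightarrow> 'a pair_pre_digraph \<Rightarrow> bool" where
  "vertex_listing vs G \<longleftrightarrow> distinct vs \<and> set vs = pverts G"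

definition adjacency_matrix :: "'a list \<Rightarrow> 'a pair_pre_digraph \<Rightarrow> real mat" where
  "adjacency_matrix vs G = mat (length vs) (length vs)
     (\<lambda>(i, j). if (vs ! i, vs ! j) \<in> parcs G then 1 else 0)"

definition distance_matrix :: "'a list \<Rightarrow> 'a pair_pre_digraph \<Rightarrow> real mat" where
  "distance_matrix vs G = mat (length vs) (length vs) (\<lambda>(i, j). graph_dist G (vs ! i) (vs ! j))"

definition transmission_matrix :: "'a list \<Rightarrow> 'a pair_pre_digraph \<Rightarrow> real mat" where
  "transmission_matrix vs G = mat (length vs) (length vs)
     (\<lambda>(i, j). if i = j then transmission G (vs ! i) else 0)"

definition distance_laplacian :: "'a list \<Rightarrow> 'a pair_pre_digraph \<Rightarrow> real mat" where
  "distance_laplacian vs G = transmission_matrix vs G - distance_matrix vs G"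

text \<open>Eigenvalues with algebraic multiplicity. Only real roots are counted, which loses nothing
  for the symmetric matrices above. (\<open>spectrum\<close> in \<open>Jordan_Normal_Form\<close> is a plain set.)\<close>

definition eigenvalue_mset :: "real mat \<Rightarrow> real multiset" where
  "eigenvalue_mset A = proots (char_poly A)"

lemma pair_graph_union:
  assumes "pair_graph G" "pair_graph H"
  shows "pair_graph (pair_union G H)"
proof -
  interpret G: pair_graph G by fact
  interpret H: pair_graph H by fact
  show ?thesis
    using G.wellformed' H.wellformed' G.pair_finite_verts H.pair_finite_verts
      G.pair_finite_arcs H.pair_finite_arcs G.no_loops' H.no_loops'
      G.arcs_symmetric H.arcs_symmetric
    by unfold_locales (auto simp: pair_union_def symmetric_def intro!: symI)
qed

lemma pair_graph_join:
  assumes "pair_graph G" "pair_graph H" "pverts G \<inter> pverts H = {}"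
  shows "pair_graph (G \<nabla> H)"
proof -
  interpret G: pair_graph G by fact
  interpret H: pair_graph H by fact
  show ?thesis
    using G.wellformed' H.wellformed' G.pair_finite_verts H.pair_finite_verts
      G.pair_finite_arcs H.pair_finite_arcs G.no_loops' H.no_loops'
      G.arcs_symmetric H.arcs_symmetric assms(3)
    by unfold_locales
      (auto simp: pair_join_def pair_union_def symmetric_def intro!: symI)
qed

lemma reachable_join:
  assumes "pair_graph G" "pair_graph H" "pverts G \<inter> pverts H = {}"
    and "pverts G \<noteq> {}" "pverts H \<noteq> {}"
    and uv: "u \<in> pverts (G \<nabla> H)" "v \<in> pverts (G \<nabla> H)"
  shows "u \<rightarrow>\<^sup>*\<^bsub>with_proj (G \<nabla> H)\<^esub> v"
proof -
  interpret J: pair_graph "G \<nabla> H" using assms by (intro pair_graph_join)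
  obtain x y where xy: "x \<in> pverts G" "y \<in> pverts H" using assms by blast
  have arc: "a \<rightarrow>\<^sup>*\<^bsub>with_proj (G \<nabla> H)\<^esub> b"
    if "a \<in> pverts G \<and> b \<in> pverts H \<or> a \<in> pverts H \<and> b \<in> pverts G" for a b
    by (rule J.reachable_adjI) (use that in \<open>auto simp: pair_join_def\<close>)
  have "u \<in> pverts G \<union> pverts H" "v \<in> pverts G \<union> pverts H"
    using uv by (auto simp: pair_join_def pair_union_def)
  then show ?thesis
    using arc xy J.reachable_trans by (metis UnE)
qed

lemma connected_join:
  assumes "pair_graph G" "pair_graph H" "pverts G \<inter> pverts H = {}"
    and "pverts G \<noteq> {}" "pverts H \<noteq> {}"
  shows "connected (with_proj (G \<nabla> H))"
proof -
  interpret J: pair_graph "G \<nabla> H" using assms by (intro pair_graph_join)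
  have "pverts (G \<nabla> H) \<noteq> {}" using assms by (auto simp: pair_join_def pair_union_def)
  then have "strongly_connected (with_proj (G \<nabla> H))"
    using reachable_join[OF assms] by (auto simp: strongly_connected_def)
  moreover have "with_proj (mk_symmetric (with_proj (G \<nabla> H))) = with_proj (G \<nabla> H)"
    using J.arcs_symmetric by (auto simp: mk_symmetric_def with_proj_def)
  ultimately show ?thesis by (simp add: connected_def)
qed

end

theory Submission
  imports Defs
begin

text \<open>
  The join has diameter at most two, so its distance Laplacian is \<open>B - e\<^sub>1 e\<^sub>1\<^sup>T - e\<^sub>2 e\<^sub>2\<^sup>T - 1 1\<^sup>T\<close>, where
  \<open>e\<^sub>1\<close> and \<open>e\<^sub>2\<close> are the indicator vectors of the vertex sets of \<open>G\<^sub>1\<close> and \<open>G\<^sub>2 \<union> G\<^sub>3\<close> and \<open>B\<close> is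
  block diagonal, each block being a scalar matrix plus the adjacency matrix of one \<open>G\<^sub>i\<close>. The
  scalars are such that \<open>e\<^sub>1\<close> and \<open>e\<^sub>2\<close> are eigenvectors of \<open>B\<close>: both blocks of \<open>G\<^sub>2 \<union> G\<^sub>3\<close> have row
  sum \<open>n\<^sub>1 + 2n\<^sub>2 + 2n\<^sub>3\<close>. By Brauer's theorem, adding \<open>x y\<^sup>T\<close> to a matrix with \<open>M x = s x\<close> replaces
  one eigenvalue \<open>s\<close> by \<open>s + y\<^sup>T x\<close> and keeps the others. Subtracting \<open>e\<^sub>1 e\<^sub>1\<^sup>T\<close> and \<open>e\<^sub>2 e\<^sub>2\<^sup>T\<close> makes
  all row sums equal to \<open>N = n\<^sub>1 + n\<^sub>2 + n\<^sub>3\<close>, so that Brauer's theorem applies to \<open>1 1\<^sup>T\<close> as well.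
\<close>

section \<open>Matrices indexed by a list of vertices\<close>

text \<open>Entries depend on vertices rather than indices, so row sums become sums over vertex
  sets, and relisting the vertices permutes rows and columns together.\<close>

definition matrix_on :: "'a list \<Rightarrow> ('a \<Rightarrow> 'a \<Rightarrow> 'b) \<Rightarrow> 'b mat" where
  "matrix_on vs f = mat (length vs) (length vs) (\<lambda>(i, j). f (vs ! i) (vs ! j))"

lemma matrix_on_carrier [simp]: "matrix_on vs f \<in> carrier_mat (length vs) (length vs)"
  by (simp add: matrix_on_def)

lemma matrix_on_cong:
  assumes "\<And>u v. u \<in> set vs \<Longrightarrow> v \<in> set vs \<Longrightarrow> f u v = g u v"
  shows "matrix_on vs f = matrix_on vs g"
  by (rule eq_matI) (auto simp: matrix_on_def assms)

text \<open>The sign of \<open>p\<close> arises twice, once from the rows and once, through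
  transposition, from the columns; the two signs cancel.\<close>

lemma det_permute_rows_cols:
  assumes A: "A \<in> carrier_mat n n" and p: "p permutes {0..<n}"
  shows "det (mat n n (\<lambda>(i, j). A $$ (p i, p j))) = (det A :: 'b :: comm_ring_1)"
proof -
  define R where "R = mat n n (\<lambda>(i, j). A $$ (p i, j))"
  have R: "R \<in> carrier_mat n n" by (simp add: R_def)
  have pn: "p i < n" if "i < n" for i
    using permutes_in_image[OF p, of i] that by simp
  have "mat n n (\<lambda>(i, j). A $$ (p i, p j)) =
      transpose_mat (mat n n (\<lambda>(i, j). transpose_mat R $$ (p i, j)))"
    by (rule eq_matI) (auto simp: R_def pn)
  then have "det (mat n n (\<lambda>(i, j). A $$ (p i, p j))) =
      det (mat n n (\<lambda>(i, j). transpose_mat R $$ (p i, j)))"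
    by (simp add: det_transpose[of _ n])
  also have "\<dots> = signof p * det R"
    using R by (subst det_permute_rows[OF _ p]) (auto simp: det_transpose)
  also have "det R = signof p * det A"
    unfolding R_def by (rule det_permute_rows[OF A p])
  finally show ?thesis by (simp add: sign_def split: if_splits)
qed

lemma det_matrix_on_mset_eq:
  fixes f :: "'a \<Rightarrow> 'a \<Rightarrow> 'b :: comm_ring_1"
  assumes "mset vs = mset ws"
  shows "det (matrix_on vs f) = det (matrix_on ws f)"
proof -
  from assms obtain p where p: "p permutes {..<length ws}" "permute_list p ws = vs"
    by (rule mset_eq_permutation)
  have len: "length vs = length ws" using assms by (metis size_mset)
  have nth: "vs ! i = ws ! p i" if "i < length ws" for i
    using p that permute_list_nth by blast
  have pn: "p i < length ws" if "i < length ws" for i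
    using permutes_in_image[OF p(1), of i] that by simp
  have "matrix_on vs f =
      mat (length ws) (length ws) (\<lambda>(i, j). matrix_on ws f $$ (p i, p j))"
    by (rule eq_matI) (auto simp: matrix_on_def len nth pn)
  then show ?thesis
    using p(1) by (simp add: det_permute_rows_cols lessThan_atLeast0)
qed

text \<open>The vanishing upper right block makes the matrix block lower triangular.\<close>

lemma det_matrix_on_append:
  fixes f :: "'a \<Rightarrow> 'a \<Rightarrow> 'b :: idom"
  assumes "\<And>u v. u \<in> set us \<Longrightarrow> v \<in> set vs \<Longrightarrow> f u v = 0"
  shows "det (matrix_on (us @ vs) f) = det (matrix_on us f) * det (matrix_on vs f)"
proof -
  let ?C = "mat (length vs) (length us) (\<lambda>(i, j). f (vs ! i) (us ! j))"
  have "matrix_on (us @ vs) f =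
      four_block_mat (matrix_on us f) (0\<^sub>m (length us) (length vs)) ?C (matrix_on vs f)"
    by (rule eq_matI) (auto simp: matrix_on_def four_block_mat_def Let_def nth_append assms)
  then show ?thesis
    by (simp add: det_four_block_mat_upper_right_zero[of _ "length us" _ "length vs"])
qed

text \<open>
  Both sides equal \<open>t\<close> times the determinant of \<open>X\<close> bordered by the column \<open>x\<close>, the row \<open>y\<close> and
  the corner \<open>1\<close>: eliminating \<open>y\<close> gives the left one, eliminating \<open>x\<close> by means of \<open>X x = t x\<close> the
  right one.
\<close>

lemma det_rank_one_update_eigenvector:
  fixes X :: "'b :: idom mat"
  assumes X: "X \<in> carrier_mat n n" and x: "x \<in> carrier_mat n 1" and y: "y \<in> carrier_mat 1 n"
    and eig: "X * x = t \<cdot>\<^sub>m x"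
  shows "det (X - x * y) * t = det X * (t - (y * x) $$ (0, 0))"
proof -
  define I where "I = (1\<^sub>m n :: 'b mat)"
  define J where "J = (1\<^sub>m 1 :: 'b mat)"
  define T where "T = t \<cdot>\<^sub>m J"
  define M where "M = four_block_mat X x y J"
  define P where "P = four_block_mat I (0\<^sub>m n 1) (- y) J"
  define Q where "Q = four_block_mat I (- x) (0\<^sub>m 1 n) T"
  have I: "I \<in> carrier_mat n n" and J: "J \<in> carrier_mat 1 1" and T: "T \<in> carrier_mat 1 1"
    and ux: "- x \<in> carrier_mat n 1" and uy: "- y \<in> carrier_mat 1 n"
    and xy: "x * y \<in> carrier_mat n n" and yx: "y * x \<in> carrier_mat 1 1"
    using x y by (auto simp: I_def J_def T_def)
  have M: "M \<in> carrier_mat (n + 1) (n + 1)" and P: "P \<in> carrier_mat (n + 1) (n + 1)"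
    and Q: "Q \<in> carrier_mat (n + 1) (n + 1)"
    using X I J T by (auto simp: M_def P_def Q_def)
  have "M * P = four_block_mat (X * I + x * (- y)) (X * 0\<^sub>m n 1 + x * J)
      (y * I + J * (- y)) (y * 0\<^sub>m n 1 + J * J)"
    unfolding M_def P_def by (rule mult_four_block_mat[OF X x y J I _ uy J]) simp
  also have "X * I + x * (- y) = X - x * y"
    using X x y xy by (intro eq_matI) (auto simp: I_def)
  also have "X * 0\<^sub>m n 1 + x * J = x"
    using X x by (simp add: J_def)
  also have "y * I + J * (- y) = 0\<^sub>m 1 n"
    using y uy by (intro eq_matI) (auto simp: I_def J_def)
  also have "y * 0\<^sub>m n 1 + J * J = J"
    using y by (simp add: J_def)
  finally have MP: "M * P = four_block_mat (X - x * y) x (0\<^sub>m 1 n) J" .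
  have "det M * det P = det (X - x * y) * det J"
    unfolding det_mult[OF M P, symmetric] MP
    by (rule det_four_block_mat_lower_left_zero[OF minus_carrier_mat[OF xy] x refl J])
  moreover have "det P = 1"
    unfolding P_def det_four_block_mat_upper_right_zero[OF I refl uy J] by (simp add: I_def J_def)
  ultimately have 1: "det M = det (X - x * y)" by (simp add: J_def)
  have "M * Q = four_block_mat (X * I + x * 0\<^sub>m 1 n) (X * (- x) + x * T)
      (y * I + J * 0\<^sub>m 1 n) (y * (- x) + J * T)"
    unfolding M_def Q_def by (rule mult_four_block_mat[OF X x y J I ux _ T]) simp
  also have "X * I + x * 0\<^sub>m 1 n = X"
    using X x by (simp add: I_def)
  also have "X * (- x) + x * T = 0\<^sub>m n 1"
  proof -
    have "X * (- x) = - (t \<cdot>\<^sub>m x)" using X x eig by simp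
    moreover have "x * T = t \<cdot>\<^sub>m x"
      unfolding T_def mult_smult_distrib[OF x J] using x by (simp add: J_def)
    ultimately show ?thesis using x by (intro eq_matI) auto
  qed
  also have "y * I + J * 0\<^sub>m 1 n = y"
    using y by (simp add: I_def J_def)
  also have "y * (- x) + J * T = T - y * x"
    using x y yx T by (intro eq_matI) (auto simp: J_def)
  finally have MQ: "M * Q = four_block_mat X (0\<^sub>m n 1) y (T - y * x)" .
  have "det M * det Q = det X * det (T - y * x)"
    unfolding det_mult[OF M Q, symmetric] MQ
    by (rule det_four_block_mat_upper_right_zero[OF X refl y minus_carrier_mat[OF yx]])
  moreover have "det Q = t"
    unfolding Q_def
    unfolding det_four_block_mat_lower_left_zero[OF I ux refl T] by (simp add: I_def T_def J_def)
  moreover have "det (T - y * x) = t - (y * x) $$ (0, 0)"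
    unfolding det_single[OF minus_carrier_mat[OF yx]] using x y by (simp add: T_def J_def)
  ultimately show ?thesis by (simp add: 1)
qed

lemma det_matrix_on_rank_one_update:
  fixes f :: "'a \<Rightarrow> 'a \<Rightarrow> 'b :: idom"
  assumes eig: "\<And>u. u \<in> set vs \<Longrightarrow> (\<Sum>v\<leftarrow>vs. f u v * x v) = t * x u"
  shows "det (matrix_on vs (\<lambda>u v. f u v - x u * y v)) * t =
    det (matrix_on vs f) * (t - (\<Sum>v\<leftarrow>vs. y v * x v))"
proof -
  let ?n = "length vs"
  let ?x = "mat ?n 1 (\<lambda>(i, _). x (vs ! i))" and ?y = "mat 1 ?n (\<lambda>(_, j). y (vs ! j))"
  have eig': "matrix_on vs f * ?x = t \<cdot>\<^sub>m ?x"
  proof (rule eq_matI)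
    fix i j assume "i < dim_row (t \<cdot>\<^sub>m ?x)" "j < dim_col (t \<cdot>\<^sub>m ?x)"
    then have ij: "i < ?n" "j = 0" by auto
    then show "(matrix_on vs f * ?x) $$ (i, j) = (t \<cdot>\<^sub>m ?x) $$ (i, j)"
      using eig[of "vs ! i"]
      by (simp add: matrix_on_def scalar_prod_def sum_list_sum_nth)
  qed (auto simp: matrix_on_def)
  have "matrix_on vs f - ?x * ?y = matrix_on vs (\<lambda>u v. f u v - x u * y v)"
    by (rule eq_matI) (auto simp: matrix_on_def scalar_prod_def)
  moreover have "(?y * ?x) $$ (0, 0) = (\<Sum>v\<leftarrow>vs. y v * x v)"
    by (simp add: scalar_prod_def sum_list_sum_nth)
  ultimately show ?thesis
    using det_rank_one_update_eigenvector[OF matrix_on_carrier _ _ eig', of ?y] by simp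
qed

section \<open>Characteristic polynomials and Brauer's theorem\<close>

text \<open>The entries of the characteristic matrix \<open>X 1 - A\<close>. The diagonal is
  recognised by equality of vertices, which agrees with equality of indices in a distinct
  listing.\<close>

definition char_entry :: "('a \<Rightarrow> 'a \<Rightarrow> 'b) \<Rightarrow> 'a \<Rightarrow> 'a \<Rightarrow> 'b :: comm_ring_1 poly" where
  "char_entry f u v = (if u = v then [:0, 1:] else 0) - [:f u v:]"

lemma char_poly_matrix_on:
  assumes "distinct vs"
  shows "char_poly (matrix_on vs f) = det (matrix_on vs (char_entry f))"
  unfolding char_poly_defs
  by (rule arg_cong[where f = det], rule eq_matI)
     (auto simp: matrix_on_def char_entry_def nth_eq_iff_index_eq[OF assms])

lemma char_poly_matrix_on_mset_eq:
  assumes "distinct vs" "mset vs = mset ws"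
  shows "char_poly (matrix_on vs f) = char_poly (matrix_on ws f)"
proof -
  have "distinct ws" using assms by (metis distinct_count_atmost_1 mset_eq_setD)
  then show ?thesis
    using assms by (simp add: char_poly_matrix_on det_matrix_on_mset_eq[OF assms(2)])
qed

lemma char_poly_matrix_on_append:
  fixes f :: "'a \<Rightarrow> 'a \<Rightarrow> 'b :: idom"
  assumes "distinct (us @ vs)" "\<And>u v. u \<in> set us \<Longrightarrow> v \<in> set vs \<Longrightarrow> f u v = 0"
  shows "char_poly (matrix_on (us @ vs) f) = char_poly (matrix_on us f) * char_poly (matrix_on vs f)"
proof -
  have "det (matrix_on (us @ vs) (char_entry f)) =
      det (matrix_on us (char_entry f)) * det (matrix_on vs (char_entry f))"
    by (rule det_matrix_on_append) (use assms in \<open>auto simp: char_entry_def\<close>)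
  then show ?thesis
    using assms(1) by (simp add: char_poly_matrix_on del: distinct_append) (simp add: char_poly_matrix_on)
qed

lemma sum_list_pCons: "(\<Sum>v\<leftarrow>vs. [:g v:]) = [:\<Sum>v\<leftarrow>vs. g v:]"
  by (induction vs) auto

text \<open>Brauer's theorem. The vector \<open>x\<close> satisfies the eigenvector equation of the
  characteristic matrix with factor \<open>X - s\<close>, and adding \<open>x y^T\<close> to the
  matrix subtracts it from the characteristic matrix, so the determinant identity applies over the
  polynomial ring.\<close>

lemma char_poly_rank_one_update:
  fixes f :: "'a \<Rightarrow> 'a \<Rightarrow> 'b :: idom"
  assumes vs: "distinct vs"
    and eig: "\<And>u. u \<in> set vs \<Longrightarrow> (\<Sum>v\<in>set vs. f u v * x v) = s * x u"
  shows "char_poly (matrix_on vs (\<lambda>u v. f u v + x u * y v)) * [:- s, 1:] =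
    char_poly (matrix_on vs f) * [:- (s + (\<Sum>v\<in>set vs. y v * x v)), 1:]"
proof -
  have 1: "char_entry (\<lambda>u v. f u v + x u * y v) =
      (\<lambda>u v. char_entry f u v - [:x u:] * [:y v:])"
    by (auto simp: char_entry_def fun_eq_iff)
  have "(\<Sum>v\<leftarrow>vs. char_entry f u v * [:x v:]) = [:- s, 1:] * [:x u:]" if u: "u \<in> set vs" for u
  proof -
    have "(\<Sum>v\<leftarrow>vs. char_entry f u v * [:x v:]) =
        (\<Sum>v\<in>set vs. (if u = v then [:0, x v:] else 0) - [:f u v * x v:])"
      by (subst sum_list_distinct_conv_sum_set[OF vs], rule sum.cong)
         (auto simp: char_entry_def algebra_simps)
    also have "\<dots> = [:0, x u:] - [:\<Sum>v\<in>set vs. f u v * x v:]"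
      using u sum_list_pCons[of "\<lambda>v. f u v * x v" vs]
      by (simp add: sum_subtractf sum_list_distinct_conv_sum_set[OF vs])
    also have "\<dots> = [:- s, 1:] * [:x u:]" using eig[OF u] by (simp add: mult.commute)
    finally show ?thesis .
  qed
  note update = det_matrix_on_rank_one_update[OF this, where y = "\<lambda>v. [:y v:]"]
  have "[:- s, 1:] - (\<Sum>v\<leftarrow>vs. [:y v:] * [:x v:]) = [:- (s + (\<Sum>v\<in>set vs. y v * x v)), 1:]"
    using sum_list_pCons[of "\<lambda>v. y v * x v" vs]
    by (simp add: sum_list_distinct_conv_sum_set[OF vs] mult.commute)
  with update show ?thesis by (simp only: char_poly_matrix_on[OF vs] 1)
qed

section \<open>Translating a spectrum by a scalar\<close>

text \<open>Substituting \<open>X - c\<close> for \<open>X\<close> turns the factor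
  \<open>(X - (a - c))^k\<close> into \<open>(X - a)^k\<close>, and the remaining cofactor still
  does not vanish at \<open>a\<close>.\<close>

lemma order_pcompose_linear:
  fixes p :: "'b :: idom poly"
  assumes "p \<noteq> 0"
  shows "order a (pcompose p [:- c, 1:]) = order (a - c) p"
proof -
  obtain q where q: "p = [:- (a - c), 1:] ^ order (a - c) p * q" "\<not> [:- (a - c), 1:] dvd q"
    using order_decomp[OF assms] by blast
  let ?k = "order (a - c) p"
  have c: "pcompose p [:- c, 1:] = [:- a, 1:] ^ ?k * pcompose q [:- c, 1:]"
    by (subst q(1)) (simp add: pcompose_mult pcompose_hom.hom_power pcompose_pCons)
  have r: "poly (pcompose q [:- c, 1:]) a \<noteq> 0"
    using q(2) by (simp add: poly_pcompose dvd_iff_poly_eq_0)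
  then have "pcompose q [:- c, 1:] \<noteq> 0" by auto
  then show ?thesis
    unfolding c using r by (subst order_mult) (auto simp: order_0I)
qed

lemma proots_pcompose_linear:
  fixes p :: "'b :: idom poly"
  shows "proots (pcompose p [:- c, 1:]) = image_mset (\<lambda>z. c + z) (proots p)"
proof (cases "p = 0")
  case False
  have nz: "pcompose p [:- c, 1:] \<noteq> 0"
    using False by (simp add: pcompose_eq_0_iff)
  show ?thesis
  proof (rule multiset_eqI)
    fix a
    \<comment> \<open>Translation is injective, so only the root \<open>a - c\<close> contributes to
      the count at \<open>a\<close>.\<close>
    have "(\<lambda>z. c + z) -` {a} = {a - c}" by (auto simp: algebra_simps)
    then have "count (image_mset (\<lambda>z. c + z) (proots p)) a = count (proots p) (a - c)"
      by (cases "a - c \<in># proots p") (simp_all add: count_image_mset not_in_iff)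
    then show "count (proots (pcompose p [:- c, 1:])) a =
        count (image_mset (\<lambda>z. c + z) (proots p)) a"
      using False nz by (simp add: order_pcompose_linear)
  qed
qed simp

text \<open>Substituting \<open>X - c\<close> for \<open>X\<close> is a ring homomorphism, hence
  commutes with the determinant; on the characteristic matrix it gives
  \<open>(X - c) 1 - M = X 1 - (c 1 + M)\<close>.\<close>

lemma char_poly_matrix_on_shift:
  fixes f :: "'a \<Rightarrow> 'a \<Rightarrow> 'b :: idom"
  assumes "distinct vs"
  shows "char_poly (matrix_on vs (\<lambda>u v. (if u = v then c else 0) + f u v)) =
    pcompose (char_poly (matrix_on vs f)) [:- c, 1:]"
proof -
  have hom: "comm_ring_hom (\<lambda>p. pcompose p [:- c, 1:])"
    by unfold_locales (auto simp: pcompose_add pcompose_mult)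
  have "map_mat (\<lambda>p. pcompose p [:- c, 1:]) (matrix_on vs (char_entry f)) =
      matrix_on vs (char_entry (\<lambda>u v. (if u = v then c else 0) + f u v))"
    by (rule eq_matI) (auto simp: matrix_on_def char_entry_def pcompose_diff pcompose_pCons)
  then show ?thesis
    using comm_ring_hom.hom_det[OF hom, of "matrix_on vs (char_entry f)"] by (simp add: char_poly_matrix_on[OF assms])
qed

section \<open>Eigenvalue multisets\<close>

lemma char_poly_matrix_on_nonzero: "char_poly (matrix_on vs f) \<noteq> (0 :: 'b :: idom poly)"
  using degree_monic_char_poly[OF matrix_on_carrier[of vs f]] by auto

text \<open>Adding an element on both sides, instead of removing \<open>s\<close> on one, avoids
  showing separately that \<open>s\<close> occurs.\<close>

lemma eigenvalue_mset_rank_one_update: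
  assumes "distinct vs"
    and "\<And>u. u \<in> set vs \<Longrightarrow> (\<Sum>v\<in>set vs. f u v * x v) = s * x u"
  shows "add_mset s (eigenvalue_mset (matrix_on vs (\<lambda>u v. f u v + x u * y v))) =
    add_mset (s + (\<Sum>v\<in>set vs. y v * x v)) (eigenvalue_mset (matrix_on vs f))"
proof -
  have "proots (char_poly (matrix_on vs (\<lambda>u v. f u v + x u * y v)) * [:- s, 1:]) =
      proots (char_poly (matrix_on vs f) * [:- (s + (\<Sum>v\<in>set vs. y v * x v)), 1:])"
    by (simp only: char_poly_rank_one_update[OF assms])
  then show ?thesis
    by (subst (asm) (1 2) proots_mult)
       (auto simp: char_poly_matrix_on_nonzero eigenvalue_mset_def)
qed

lemma eigenvalue_mset_append:
  assumes "distinct (us @ vs)" "\<And>u v. u \<in> set us \<Longrightarrow> v \<in> set vs \<Longrightarrow> f u v = 0"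
  shows "eigenvalue_mset (matrix_on (us @ vs) f) =
    eigenvalue_mset (matrix_on us f) + eigenvalue_mset (matrix_on vs f)"
  using char_poly_matrix_on_append[of us vs f] assms
  by (simp add: eigenvalue_mset_def proots_mult char_poly_matrix_on_nonzero)

lemma eigenvalue_mset_shift:
  assumes "distinct vs"
  shows "eigenvalue_mset (matrix_on vs (\<lambda>u v. (if u = v then c else 0) + f u v)) =
    image_mset (\<lambda>z. c + z) (eigenvalue_mset (matrix_on vs f))"
  by (simp add: eigenvalue_mset_def char_poly_matrix_on_shift[OF assms] proots_pcompose_linear)

section \<open>Distances and degrees in graphs\<close>

text \<open>With unit weights the cost of a walk is its length, and the infimum over all walks is
  attained at \<open>p\<close>. It is therefore finite and survives the conversion to
  \<open>real\<close>.\<close>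

lemma (in pair_wf_digraph) graph_dist_eq_length:
  assumes "awalk u p v" "\<And>q. awalk u q v \<Longrightarrow> length p \<le> length q"
  shows "graph_dist G u v = real (length p)"
proof -
  have cost: "awalk_cost (\<lambda>_. 1) q = real (length q)" for q :: "('a \<times> 'a) list"
    by (induction q) auto
  have "\<mu> (\<lambda>_. 1) u v = ereal (real (length p))"
    unfolding \<mu>_def cost using assms by (intro antisym INF_lower INF_greatest) auto
  then show ?thesis by (simp add: graph_dist_def)
qed

text \<open>A walk between distinct vertices has at least one arc, and at least two if they are not
  adjacent. Explicit walks of length 0, 1 and 2 attain these bounds.\<close>

lemma (in pair_wf_digraph) graph_dist_diameter_two:
  assumes u: "u \<in> pverts G"
    and two: "u \<noteq> v \<Longrightarrow> (u, v) \<notin> parcs G \<Longrightarrow> \<exists>w. (u, w) \<in> parcs G \<and> (w, v) \<in> parcs G"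
  shows "graph_dist G u v = (if u = v then 0 else if (u, v) \<in> parcs G then 1 else 2)"
proof -
  have ne: "length q \<ge> 1" if "awalk u q v" "u \<noteq> v" for q
    using that by (cases q) (auto simp: awalk_Nil_iff)
  have ge2: "length q \<ge> 2" if q: "awalk u q v" "u \<noteq> v" "(u, v) \<notin> parcs G" for q
  proof (rule ccontr)
    assume "\<not> length q \<ge> 2"
    with ne[OF q(1,2)] obtain e where "q = [e]"
      by (cases q) (auto simp: Suc_le_eq)
    with q show False by (cases e) (auto simp: awalk_Cons_iff awalk_Nil_iff)
  qed
  consider "u = v" | "u \<noteq> v" "(u, v) \<in> parcs G"
    | w where "u \<noteq> v" "(u, v) \<notin> parcs G" "(u, w) \<in> parcs G" "(w, v) \<in> parcs G"
    using two by blast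
  then show ?thesis
  proof cases
    case 1
    then show ?thesis
      using u graph_dist_eq_length[of u "[]" v] by (simp add: awalk_Nil_iff)
  next
    case 2
    then have "awalk u [(u, v)] v" by (auto simp: awalk_Cons_iff awalk_Nil_iff in_arcsD2)
    then show ?thesis using 2 ne graph_dist_eq_length[of u "[(u, v)]" v] by simp
  next
    case 3
    then have "awalk u [(u, w), (w, v)] v"
      by (auto simp: awalk_Cons_iff awalk_Nil_iff in_arcsD2)
    then show ?thesis using 3 ge2 graph_dist_eq_length[of u "[(u, w), (w, v)]" v]
      by (simp add: numeral_2_eq_2)
  qed
qed

text \<open>Pairing with \<open>u\<close> is a bijection from the neighbours of \<open>u\<close> to
  the arcs leaving \<open>u\<close>, which the out-degree counts.\<close>

lemma regular_graph_sum_adjacency: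
  assumes "regular_graph r G" "u \<in> pverts G"
  shows "(\<Sum>v\<in>pverts G. of_bool ((u, v) \<in> parcs G)) = real r"
proof -
  interpret pair_graph G using assms(1) by (simp add: regular_graph_def)
  have "r = card {e \<in> parcs G. fst e = u}"
    using assms by (auto simp: regular_graph_def out_degree_def out_arcs_def)
  also have "{e \<in> parcs G. fst e = u} = Pair u ` {v \<in> pverts G. (u, v) \<in> parcs G}"
    by (auto dest: in_arcsD2)
  also have "card \<dots> = card {v \<in> pverts G. (u, v) \<in> parcs G}"
    by (rule card_image) (auto simp: inj_on_def)
  finally show ?thesis
    using pair_finite_verts by (simp add: of_bool_def sum.If_cases Int_def)
qed

lemma adjacency_matrix_eq_matrix_on:
  "adjacency_matrix vs G = matrix_on vs (\<lambda>u v. of_bool ((u, v) \<in> parcs G))"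
  by (rule eq_matI) (auto simp: adjacency_matrix_def matrix_on_def)

lemma distance_laplacian_eq_matrix_on:
  assumes "distinct vs"
  shows "distance_laplacian vs G =
    matrix_on vs (\<lambda>u v. (if u = v then transmission G u else 0) - graph_dist G u v)"
  by (rule eq_matI)
     (auto simp: distance_laplacian_def transmission_matrix_def distance_matrix_def matrix_on_def
        nth_eq_iff_index_eq[OF assms])

section \<open>The spectrum of the join\<close>

theorem theorem3p15:
  fixes G1 G2 G3 :: "'a pair_pre_digraph"
    and n1 n2 n3 r1 r2 r3 :: nat
    and lam mu del :: "nat \<Rightarrow> real"
    and vs1 vs2 vs3 vs :: "'a list"
  assumes "regular_graph r1 G1" "regular_graph r2 G2" "regular_graph r3 G3"
    and "card (pverts G1) = n1" "card (pverts G2) = n2" "card (pverts G3) = n3"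
    and "n1 \<ge> 1" "n2 \<ge> 1" "n3 \<ge> 1"
    and "pverts G1 \<inter> pverts G2 = {}" "pverts G1 \<inter> pverts G3 = {}" "pverts G2 \<inter> pverts G3 = {}"
    and "vertex_listing vs1 G1" "vertex_listing vs2 G2" "vertex_listing vs3 G3"
    and "eigenvalue_mset (adjacency_matrix vs1 G1) = image_mset lam (mset_set {1..n1})"
    and "eigenvalue_mset (adjacency_matrix vs2 G2) = image_mset mu (mset_set {1..n2})"
    and "eigenvalue_mset (adjacency_matrix vs3 G3) = image_mset del (mset_set {1..n3})"
    and "lam 1 = real r1" "mu 1 = real r2" "del 1 = real r3"
    and "vertex_listing vs (G1 \<nabla> pair_union G2 G3)"
  shows "eigenvalue_mset (distance_laplacian vs (G1 \<nabla> pair_union G2 G3)) =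
      {# 0, real n1 + real n2 + real n3, real n1 + 2 * real n2 + 2 * real n3 #}
    + image_mset (\<lambda>j. 2 * real n1 + real n2 + real n3 - real r1 + lam j) (mset_set {2..n1})
    + image_mset (\<lambda>j. real n1 + 2 * real n2 + 2 * real n3 - real r2 + mu j) (mset_set {2..n2})
    + image_mset (\<lambda>j. real n1 + 2 * real n2 + 2 * real n3 - real r3 + del j) (mset_set {2..n3})"
proof -
  let ?J = "G1 \<nabla> pair_union G2 G3"
  let ?V1 = "pverts G1" and ?V2 = "pverts G2" and ?V3 = "pverts G3"
  let ?V = "?V1 \<union> ?V2 \<union> ?V3"
  define N where "N = real n1 + real n2 + real n3"
  \<comment> \<open>The prescribed row sums of \<open>B\<close>: \<open>s1 = N + n1\<close> and
    \<open>s2 = N + (n2 + n3)\<close>, so that subtracting the two all-ones blocks leaves row sum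
    \<open>N\<close> throughout.\<close>
  define s1 where "s1 = 2 * real n1 + real n2 + real n3"
  define s2 where "s2 = real n1 + 2 * real n2 + 2 * real n3"
  define a where "a u = (if u \<in> ?V1 then s1 - real r1
      else if u \<in> ?V2 then s2 - real r2 else s2 - real r3)" for u
  \<comment> \<open>Only the arcs inside the three graphs; the arcs added by the join are expressed
    through \<open>e1\<close> and \<open>e2\<close>.\<close>
  define E where "E = parcs G1 \<union> parcs G2 \<union> parcs G3"
  define A where "A u v = (of_bool ((u, v) \<in> E) :: real)" for u v
  define B where "B u v = (if u = v then a u else 0) + A u v" for u v
  define e1 where "e1 u = (of_bool (u \<in> ?V1) :: real)" for u
  define e2 where "e2 u = (of_bool (u \<in> ?V2 \<union> ?V3) :: real)" for u
  define C where "C u v = B u v + e1 u * - e1 v" for u v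
  define K where "K u v = C u v + e2 u * - e2 v" for u v
  have G: "pair_graph G1" "pair_graph G2" "pair_graph G3"
    using assms(1-3) by (auto simp: regular_graph_def)
  interpret G1: pair_graph G1 by (rule G)
  interpret G2: pair_graph G2 by (rule G)
  interpret G3: pair_graph G3 by (rule G)
  note wf = G1.wellformed' G2.wellformed' G3.wellformed'
  note disj = assms(10-12)
  have parts: "u \<in> ?V1 \<and> u \<notin> ?V2 \<and> u \<notin> ?V3 \<or> u \<notin> ?V1 \<and> u \<in> ?V2 \<and> u \<notin> ?V3
      \<or> u \<notin> ?V1 \<and> u \<notin> ?V2 \<and> u \<in> ?V3" if "u \<in> ?V" for u
    using that disj by blast
  have E1: "(u, v) \<in> E \<longleftrightarrow> (u, v) \<in> parcs G1" if "v \<in> ?V1" for u v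
    using that disj wf unfolding E_def by blast
  have E2: "(u, v) \<in> E \<longleftrightarrow> (u, v) \<in> parcs G2" if "v \<in> ?V2" for u v
    using that disj wf unfolding E_def by blast
  have E3: "(u, v) \<in> E \<longleftrightarrow> (u, v) \<in> parcs G3" if "v \<in> ?V3" for u v
    using that disj wf unfolding E_def by blast
  have E_cross: "u \<in> ?V1 \<longleftrightarrow> v \<in> ?V1" if "(u, v) \<in> E" for u v
    using that disj wf unfolding E_def by blast
  interpret J: pair_graph ?J
    using G disj by (intro pair_graph_join pair_graph_union) (auto simp: pair_union_def)
  have VJ: "pverts ?J = ?V" by (auto simp: pair_join_def pair_union_def)
  have EJ: "parcs ?J = E \<union> ?V1 \<times> (?V2 \<union> ?V3) \<union> (?V2 \<union> ?V3) \<times> ?V1"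
    by (auto simp: pair_join_def pair_union_def E_def)
  have vs: "distinct vs" "set vs = ?V" using assms(22) by (auto simp: vertex_listing_def VJ)
  have fin: "finite ?V1" "finite ?V2" "finite ?V3"
    using G1.pair_finite_verts G2.pair_finite_verts G3.pair_finite_verts by auto
  have split: "(\<Sum>v\<in>?V. g v) = (\<Sum>v\<in>?V1. g v) + (\<Sum>v\<in>?V2. g v) + (\<Sum>v\<in>?V3. g v)"
    for g :: "'a \<Rightarrow> real"
  proof -
    have "(?V1 \<union> ?V2) \<inter> ?V3 = {}" using disj by auto
    then show ?thesis using fin disj by (simp add: sum.union_disjoint)
  qed
  have cards: "real (card ?V1) = real n1" "real (card ?V2) = real n2" "real (card ?V3) = real n3"
    using assms(4-6) by auto
  have cardV: "real (card ?V) = N"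
    using split[of "\<lambda>_. 1"] by (simp add: cards N_def)
  have ne: "?V1 \<noteq> {}" "?V2 \<noteq> {}" using assms(4,5,7,8) by auto

  \<comment> \<open>Row sums and eigenvectors of \<open>B\<close>, \<open>C\<close> and
    \<open>K\<close>\<close>
  have A1: "(\<Sum>v\<in>?V1. A u v) = (if u \<in> ?V1 then real r1 else 0)" for u
  proof -
    have "(\<Sum>v\<in>?V1. A u v) = (\<Sum>v\<in>?V1. of_bool ((u, v) \<in> parcs G1))"
      by (intro sum.cong) (simp_all add: A_def E1)
    also have "\<dots> = (if u \<in> ?V1 then real r1 else 0)"
      using regular_graph_sum_adjacency[OF assms(1)] G1.in_arcsD1
      by (auto intro!: sum.neutral)
    finally show ?thesis .
  qed
  have A2: "(\<Sum>v\<in>?V2. A u v) = (if u \<in> ?V2 then real r2 else 0)" for u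
  proof -
    have "(\<Sum>v\<in>?V2. A u v) = (\<Sum>v\<in>?V2. of_bool ((u, v) \<in> parcs G2))"
      by (intro sum.cong) (simp_all add: A_def E2)
    also have "\<dots> = (if u \<in> ?V2 then real r2 else 0)"
      using regular_graph_sum_adjacency[OF assms(2)] G2.in_arcsD1
      by (auto intro!: sum.neutral)
    finally show ?thesis .
  qed
  have A3: "(\<Sum>v\<in>?V3. A u v) = (if u \<in> ?V3 then real r3 else 0)" for u
  proof -
    have "(\<Sum>v\<in>?V3. A u v) = (\<Sum>v\<in>?V3. of_bool ((u, v) \<in> parcs G3))"
      by (intro sum.cong) (simp_all add: A_def E3)
    also have "\<dots> = (if u \<in> ?V3 then real r3 else 0)"
      using regular_graph_sum_adjacency[OF assms(3)] G3.in_arcsD1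
      by (auto intro!: sum.neutral)
    finally show ?thesis .
  qed
  have e1: "e1 u = 1" if "u \<in> ?V1" for u using that by (simp add: e1_def)
  have e1': "e1 u = 0" if "u \<in> ?V2 \<or> u \<in> ?V3" for u using that disj by (auto simp: e1_def)
  have e2: "e2 u = 0" if "u \<in> ?V1" for u using that disj by (auto simp: e2_def)
  have e2': "e2 u = 1" if "u \<in> ?V2 \<or> u \<in> ?V3" for u using that by (auto simp: e2_def)
  note es = e1 e1' e2 e2'

  have rowB1: "(\<Sum>v\<in>?V. B u v * e1 v) = s1 * e1 u" if "u \<in> ?V" for u
    using parts[OF that] fin
    by (auto simp: split es B_def sum.distrib A1 sum.delta a_def algebra_simps)
  have rowB2: "(\<Sum>v\<in>?V. B u v * e2 v) = s2 * e2 u" if "u \<in> ?V" for u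
    using parts[OF that] fin
    by (auto simp: split es B_def sum.distrib A2 A3 sum.delta a_def algebra_simps)
  have e11: "(\<Sum>v\<in>?V. e1 v * e1 v) = real n1" by (simp add: split es cards)
  have e12: "(\<Sum>v\<in>?V. e1 v * e2 v) = 0" by (simp add: split es)
  have e22: "(\<Sum>v\<in>?V. e2 v * e2 v) = real n2 + real n3" by (simp add: split es cards)
  \<comment> \<open>Since \<open>e1\<close> and \<open>e2\<close> are orthogonal, the first update
    does not disturb the eigenvector \<open>e2\<close>.\<close>
  have rowC: "(\<Sum>v\<in>?V. C u v * e2 v) = s2 * e2 u" if "u \<in> ?V" for u
  proof -
    have "(\<Sum>v\<in>?V. C u v * e2 v) = (\<Sum>v\<in>?V. B u v * e2 v) - e1 u * (\<Sum>v\<in>?V. e1 v * e2 v)"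
      by (simp only: C_def sum_distrib_left sum_subtractf[symmetric]) (simp add: algebra_simps)
    then show ?thesis by (simp add: rowB2[OF that] e12)
  qed
  have rowK: "(\<Sum>v\<in>?V. K u v * 1) = N * 1" if u: "u \<in> ?V" for u
  proof -
    \<comment> \<open>On \<open>?V\<close> the indicators are idempotent and add up to 1, which
      reduces the row sum to the sums already computed.\<close>
    have "(\<Sum>v\<in>?V. K u v * 1) = (\<Sum>v\<in>?V. (B u v * e1 v + B u v * e2 v)
        - (e1 u * (e1 v * e1 v) + e2 u * (e2 v * e2 v)))"
      by (rule sum.cong) (auto simp: K_def C_def es)
    also have "\<dots> = s1 * e1 u + s2 * e2 u - (e1 u * real n1 + e2 u * (real n2 + real n3))"
      by (simp only: sum_subtractf sum.distrib sum_distrib_left[symmetric] rowB1[OF u] rowB2[OF u] e11 e22)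
    also have "\<dots> = N" using u by (auto simp: es s1_def s2_def N_def)
    finally show ?thesis by simp
  qed

  \<comment> \<open>Distances and transmissions in the join\<close>
  have dist: "graph_dist ?J u v = (if u = v then 0 else 2 - (A u v + e1 u * e2 v + e2 u * e1 v))"
    if uv: "u \<in> ?V" "v \<in> ?V" for u v
  proof -
    obtain x y where xy: "x \<in> ?V1" "y \<in> ?V2" using ne by blast
    \<comment> \<open>Non-adjacent vertices lie on the same side of the join, so any vertex of the
      other side is a common neighbour: \<open>y\<close> for \<open>?V1\<close>, \<open>x\<close>
      otherwise.\<close>
    have "\<exists>w. (u, w) \<in> parcs ?J \<and> (w, v) \<in> parcs ?J" if "(u, v) \<notin> parcs ?J"
      using uv that xy unfolding EJ
      by (cases "u \<in> ?V1") (auto intro: exI[of _ x] exI[of _ y])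
    then have "graph_dist ?J u v = (if u = v then 0 else if (u, v) \<in> parcs ?J then 1 else 2)"
      using uv by (intro J.graph_dist_diameter_two) (auto simp: VJ)
    \<comment> \<open>The three terms never overlap: \<open>E\<close> does not cross the two sides,
      and each product covers one direction of crossing.\<close>
    moreover have "A u v + e1 u * e2 v + e2 u * e1 v = of_bool ((u, v) \<in> parcs ?J)"
      using parts[OF uv(1)] parts[OF uv(2)] E_cross[of u v]
      unfolding EJ A_def e1_def e2_def by auto
    ultimately show ?thesis by simp
  qed
  have A0: "A u u = 0" for u
  proof -
    have "(u, u) \<notin> E"
      using G1.no_loops' G2.no_loops' G3.no_loops' unfolding E_def by blast
    then show ?thesis by (simp add: A_def)
  qed
  have trans: "transmission ?J u = a u - 2" if u: "u \<in> ?V" for u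
  proof -
    \<comment> \<open>The off-diagonal formula would give 2 at \<open>v = u\<close>, where the
      distance is 0; the last term corrects this and is the source of the
      \<open>- 2\<close>.\<close>
    have "transmission ?J u =
        (\<Sum>v\<in>?V. 2 - (A u v + e1 u * e2 v + e2 u * e1 v) - (if u = v then 2 else 0))"
      unfolding transmission_def VJ using u
      by (intro sum.cong) (auto simp: dist A0 es)
    also have "\<dots> = a u - 2"
      using parts[OF u] fin
      by (auto simp: split es sum.distrib sum_subtractf A1 A2 A3 sum.delta a_def cardV assms(4-6) N_def s1_def s2_def)
    finally show ?thesis by simp
  qed
  \<comment> \<open>Since \<open>(e1 u + e2 u) * (e1 v + e2 v) = 1\<close>, the cross products in
    the distance equal 1 minus the same-side products occurring in \<open>K\<close>.\<close>
  have L: "distance_laplacian vs ?J = matrix_on vs (\<lambda>u v. K u v + 1 * (- 1))"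
    unfolding distance_laplacian_eq_matrix_on[OF vs(1)]
  proof (rule matrix_on_cong)
    fix u v assume "u \<in> set vs" "v \<in> set vs"
    then show "(if u = v then transmission ?J u else 0) - graph_dist ?J u v = K u v + 1 * (- 1)"
      unfolding vs by (auto simp: trans dist K_def C_def B_def A0 es)
  qed

  \<comment> \<open>Three applications of Brauer's theorem\<close>
  let ?m = "\<lambda>f. eigenvalue_mset (matrix_on vs f)"
  have 1: "add_mset s1 (?m C) = add_mset N (?m B)"
  proof -
    have "s1 + (\<Sum>v\<in>?V. - e1 v * e1 v) = N"
      using e11 by (simp add: sum_negf s1_def N_def)
    then show ?thesis
      using eigenvalue_mset_rank_one_update[OF vs(1), of B e1 s1 "\<lambda>v. - e1 v"] rowB1
      by (simp add: vs C_def[abs_def])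
  qed
  have 2: "add_mset s2 (?m K) = add_mset N (?m C)"
  proof -
    have "s2 + (\<Sum>v\<in>?V. - e2 v * e2 v) = N"
      using e22 by (simp add: sum_negf s2_def N_def)
    then show ?thesis
      using eigenvalue_mset_rank_one_update[OF vs(1), of C e2 s2 "\<lambda>v. - e2 v"] rowC
      by (simp add: vs K_def[abs_def])
  qed
  have 3: "add_mset N (eigenvalue_mset (distance_laplacian vs ?J)) = add_mset 0 (?m K)"
  proof -
    \<comment> \<open>There are \<open>N\<close> vertices, so the last update moves one eigenvalue
      \<open>N\<close> to 0.\<close>
    have "N + (\<Sum>v\<in>?V. - 1 * 1) = 0"
      by (simp add: cardV)
    then show ?thesis
      using eigenvalue_mset_rank_one_update[OF vs(1), of K "\<lambda>_. 1" N "\<lambda>_. - 1"] rowK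
      by (simp only: vs L)
  qed

  \<comment> \<open>Spectrum of the block diagonal matrix\<close>
  have B0: "B u v = 0" if "u \<in> ?V1 \<and> v \<in> ?V2 \<union> ?V3 \<or> u \<in> ?V2 \<and> v \<in> ?V3" for u v
  proof -
    have "u \<noteq> v" using that disj by blast
    moreover have "(u, v) \<notin> E" using that disj wf unfolding E_def by blast
    ultimately show ?thesis by (simp add: B_def A_def)
  qed
  have vsi: "distinct vs1" "set vs1 = ?V1" "distinct vs2" "set vs2 = ?V2" "distinct vs3" "set vs3 = ?V3"
    using assms(13-15) by (auto simp: vertex_listing_def)
  \<comment> \<open>The given listing may interleave the three vertex sets; reordering it makes the
    blocks contiguous.\<close>
  have "mset vs = mset (vs1 @ vs2 @ vs3)"
    using vs vsi disj by (intro set_eq_iff_mset_eq_distinct[THEN iffD1]) auto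
  then have "?m B = eigenvalue_mset (matrix_on (vs1 @ vs2 @ vs3) B)"
    using vs(1) unfolding eigenvalue_mset_def by (metis char_poly_matrix_on_mset_eq)
  also have "\<dots> = eigenvalue_mset (matrix_on vs1 B) + eigenvalue_mset (matrix_on (vs2 @ vs3) B)"
    using vsi disj by (intro eigenvalue_mset_append) (auto intro!: B0)
  also have "eigenvalue_mset (matrix_on (vs2 @ vs3) B) =
      eigenvalue_mset (matrix_on vs2 B) + eigenvalue_mset (matrix_on vs3 B)"
    using vsi disj by (intro eigenvalue_mset_append) (auto intro!: B0)
  also have "matrix_on vs1 B =
      matrix_on vs1 (\<lambda>u v. (if u = v then s1 - real r1 else 0) + of_bool ((u, v) \<in> parcs G1))"
    using disj by (intro matrix_on_cong) (auto simp: vsi B_def A_def E1 a_def)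
  also have "matrix_on vs2 B =
      matrix_on vs2 (\<lambda>u v. (if u = v then s2 - real r2 else 0) + of_bool ((u, v) \<in> parcs G2))"
    using disj by (intro matrix_on_cong) (auto simp: vsi B_def A_def E2 a_def)
  also have "matrix_on vs3 B =
      matrix_on vs3 (\<lambda>u v. (if u = v then s2 - real r3 else 0) + of_bool ((u, v) \<in> parcs G3))"
    using disj by (intro matrix_on_cong) (auto simp: vsi B_def A_def E3 a_def)
  finally have mB: "?m B =
      image_mset (\<lambda>j. s1 - real r1 + lam j) (mset_set {1..n1})
      + (image_mset (\<lambda>j. s2 - real r2 + mu j) (mset_set {1..n2})
      + image_mset (\<lambda>j. s2 - real r3 + del j) (mset_set {1..n3}))"
    by (simp add: eigenvalue_mset_shift vsi adjacency_matrix_eq_matrix_on[symmetric] assms(16-18)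
        image_mset.compositionality comp_def)

  \<comment> \<open>Collecting the eigenvalues\<close>
  have first: "image_mset f (mset_set {1..n}) = add_mset (f 1) (image_mset f (mset_set {2..n}))"
    if "n \<ge> 1" for n and f :: "nat \<Rightarrow> real"
  proof -
    have "{1..n} = insert 1 {2..n}" using that by auto
    then show ?thesis by simp
  qed
  define R where "R = image_mset (\<lambda>j. s1 - real r1 + lam j) (mset_set {2..n1})
      + image_mset (\<lambda>j. s2 - real r2 + mu j) (mset_set {2..n2})
      + image_mset (\<lambda>j. s2 - real r3 + del j) (mset_set {2..n3})"
  \<comment> \<open>The eigenvalue with index 1 in each graph is its degree, which cancels against
    the subtracted \<open>r1\<close>, \<open>r2\<close> or \<open>r3\<close> and leaves the row sum
    of the block.\<close>
  have "?m B = {# s1, s2, s2 #} + R"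
    unfolding R_def mB first[OF assms(7)] first[OF assms(8)] first[OF assms(9)] assms(19-21)
    by (simp add: ac_simps)
  \<comment> \<open>The relations now turn \<open>s1\<close> into \<open>N\<close>, one copy of
    \<open>s2\<close> into \<open>N\<close>, and one copy of \<open>N\<close> into 0. The other copy
    of \<open>s2\<close> survives as the eigenvalue \<open>n1 + 2 n2 + 2 n3\<close>.\<close>
  then have "?m C = {# N, s2, s2 #} + R" using 1 by (simp add: add_mset_commute)
  then have "?m K = {# N, N, s2 #} + R" using 2 by (simp add: add_mset_commute)
  then have "eigenvalue_mset (distance_laplacian vs ?J) = {# 0, N, s2 #} + R"
    using 3 by (simp add: add_mset_commute)
  then show ?thesis
    by (simp add: R_def N_def s1_def s2_def ac_simps)
qed

end
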